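(* Let $n\ge1$ and let $\Bbbk$ be a field. The decomposition of $\Bbbk\,\mathcal{PF}_n$ into a direct product of connected algebras is $$\Bbbk\,\mathcal{PF}_n\simeq\Bbbk\times\Bbbk_0\,\mathcal{PF}_n .$$
   Context: $\mathcal{PF}_n$ is the monoid of all order-decreasing partial functions $f$ on $\{1,\dots,n\}$ ($f(x)\le x$ for every $x$ in the domain of $f$); its zero element is the empty function. $\Bbbk M$ denotes the monoid algebra of a monoid $M$; if $M$ has a zero element $0$, then $\Bbbk_0M=\Bbbk M/\Bbbk\{0\}$, where $\Bbbk\{0\}$ is the ideal spanned by the zero element of $M$. An algebra is connected if $0$ and $1$ are its only central idempotents. *)

theory Defs
  imports "HOL-Algebra.Chinese_Remainder" "HOL-Algebra.Module"
begin

section \<open>Algebras over a field\<close>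

text \<open>
  The locale \<^locale>\<open>algebra\<close> of the library covers commutative algebras only, hence the
  following notion of an associative, unital, not necessarily commutative algebra. Algebras are
  encoded, as in the library, as \<open>module\<close> records, that is, ring records with a scalar
  multiplication.
\<close>

definition unital_algebra ::
    "('k, 'p) ring_scheme \<Rightarrow> ('k, 'a, 'q) module_scheme \<Rightarrow> bool" where
  "unital_algebra K A \<longleftrightarrow> ring A \<and> module K A \<and>
     (\<forall>c\<in>carrier K. \<forall>x\<in>carrier A. \<forall>y\<in>carrier A.
        (c \<odot>\<^bsub>A\<^esub> x) \<otimes>\<^bsub>A\<^esub> y = c \<odot>\<^bsub>A\<^esub> (x \<otimes>\<^bsub>A\<^esub> y) \<and>
        x \<otimes>\<^bsub>A\<^esub> (c \<odot>\<^bsub>A\<^esub> y) = c \<odot>\<^bsub>A\<^esub> (x \<otimes>\<^bsub>A\<^esub> y))"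

definition algebra_isomorphic ::
    "('k, 'p) ring_scheme \<Rightarrow> ('k, 'a, 'q) module_scheme \<Rightarrow> ('k, 'b, 'r) module_scheme \<Rightarrow> bool" where
  "algebra_isomorphic K A B \<longleftrightarrow>
     (\<exists>h\<in>ring_iso A B. \<forall>c\<in>carrier K. \<forall>x\<in>carrier A. h (c \<odot>\<^bsub>A\<^esub> x) = c \<odot>\<^bsub>B\<^esub> h x)"

definition central_idempotents :: "('a, 'q) ring_scheme \<Rightarrow> 'a set" where
  "central_idempotents A =
     {e \<in> carrier A. e \<otimes>\<^bsub>A\<^esub> e = e \<and> (\<forall>x\<in>carrier A. e \<otimes>\<^bsub>A\<^esub> x = x \<otimes>\<^bsub>A\<^esub> e)}"

definition connected_algebra ::
    "('k, 'p) ring_scheme \<Rightarrow> ('k, 'a, 'q) module_scheme \<Rightarrow> bool" where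
  "connected_algebra K A \<longleftrightarrow>
     unital_algebra K A \<and> central_idempotents A = {\<zero>\<^bsub>A\<^esub>, \<one>\<^bsub>A\<^esub>}"

definition base_algebra :: "('k, 'p) ring_scheme \<Rightarrow> ('k, 'k) module" where
  "base_algebra K =
     ring.extend (ring.truncate K) \<lparr>smult = (\<lambda>c x. c \<otimes>\<^bsub>K\<^esub> x)\<rparr>"

definition product_algebra ::
    "('k, 'a, 'q) module_scheme \<Rightarrow> ('k, 'b, 'r) module_scheme \<Rightarrow> ('k, 'a \<times> 'b) module" where
  "product_algebra A B =
     ring.extend (RDirProd A B) \<lparr>smult = (\<lambda>c (x, y). (c \<odot>\<^bsub>A\<^esub> x, c \<odot>\<^bsub>B\<^esub> y))\<rparr>"

text \<open>
  The scalar action on cosets is written in the style of \<^const>\<open>rcoset_mult\<close>: if \<open>I\<close> is an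
  ideal stable under scalars, then \<open>c\<close> sends the coset of \<open>x\<close> to the coset of \<open>c x\<close>.
\<close>

definition quotient_algebra ::
    "('k, 'a, 'q) module_scheme \<Rightarrow> 'a set \<Rightarrow> ('k, 'a set) module" where
  "quotient_algebra A I =
     ring.extend (A Quot I) \<lparr>smult = (\<lambda>c X. \<Union>x\<in>X. I +>\<^bsub>A\<^esub> (c \<odot>\<^bsub>A\<^esub> x))\<rparr>"

section \<open>Monoid algebras\<close>

definition basis_element ::
    "('k, 'p) ring_scheme \<Rightarrow> ('m, 'q) monoid_scheme \<Rightarrow> 'm \<Rightarrow> 'm \<Rightarrow> 'k" where
  "basis_element K M m = (\<lambda>x\<in>carrier M. if x = m then \<one>\<^bsub>K\<^esub> else \<zero>\<^bsub>K\<^esub>)"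

text \<open>
  The formal combination of the elements \<open>m\<close> of \<open>M\<close> with coefficients \<open>f m\<close> is encoded as the
  finitely supported function \<open>f\<close>, which is \<^const>\<open>undefined\<close> outside the carrier of \<open>M\<close>.
\<close>

definition monoid_algebra ::
    "('k, 'p) ring_scheme \<Rightarrow> ('m, 'q) monoid_scheme \<Rightarrow> ('k, 'm \<Rightarrow> 'k) module" where
  "monoid_algebra K M =
     \<lparr>carrier = {f \<in> carrier M \<rightarrow>\<^sub>E carrier K. finite {m \<in> carrier M. f m \<noteq> \<zero>\<^bsub>K\<^esub>}},
      mult = (\<lambda>f g. \<lambda>m\<in>carrier M.
        finsum K (\<lambda>(x, y). f x \<otimes>\<^bsub>K\<^esub> g y)
          {(x, y) \<in> carrier M \<times> carrier M.
             f x \<noteq> \<zero>\<^bsub>K\<^esub> \<and> g y \<noteq> \<zero>\<^bsub>K\<^esub> \<and> x \<otimes>\<^bsub>M\<^esub> y = m}),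
      one = basis_element K M \<one>\<^bsub>M\<^esub>,
      zero = (\<lambda>m\<in>carrier M. \<zero>\<^bsub>K\<^esub>),
      add = (\<lambda>f g. \<lambda>m\<in>carrier M. f m \<oplus>\<^bsub>K\<^esub> g m),
      smult = (\<lambda>c f. \<lambda>m\<in>carrier M. c \<otimes>\<^bsub>K\<^esub> f m)\<rparr>"

definition is_monoid_zero :: "('m, 'q) monoid_scheme \<Rightarrow> 'm \<Rightarrow> bool" where
  "is_monoid_zero M z \<longleftrightarrow>
     z \<in> carrier M \<and> (\<forall>x\<in>carrier M. z \<otimes>\<^bsub>M\<^esub> x = z \<and> x \<otimes>\<^bsub>M\<^esub> z = z)"

text \<open>
  The contracted algebra is only meaningful if \<open>z\<close> is the (necessarily unique) zero element
  of \<open>M\<close>.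
\<close>

definition contracted_monoid_algebra ::
    "('k, 'p) ring_scheme \<Rightarrow> ('m, 'q) monoid_scheme \<Rightarrow> 'm \<Rightarrow> ('k, ('m \<Rightarrow> 'k) set) module" where
  "contracted_monoid_algebra K M z =
     quotient_algebra (monoid_algebra K M)
       {c \<odot>\<^bsub>monoid_algebra K M\<^esub> basis_element K M z | c. c \<in> carrier K}"

section \<open>Order-decreasing partial functions\<close>

text \<open>Products are compositions of partial functions, the right factor being applied first.\<close>

definition PF :: "nat \<Rightarrow> (nat \<rightharpoonup> nat) monoid" where
  "PF n =
     \<lparr>carrier = {f. dom f \<subseteq> {1..n} \<and> ran f \<subseteq> {1..n} \<and> (\<forall>x y. f x = Some y \<longrightarrow> y \<le> x)},
      mult = (\<lambda>f g. f \<circ>\<^sub>m g),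
      one = Some |` {1..n}\<rparr>"

lemma monoid_PF: "monoid (PF n)"
proof (rule monoidI)
  fix f g assume f: "f \<in> carrier (PF n)" and g: "g \<in> carrier (PF n)"
  have "x \<in> {1..n} \<and> y \<in> {1..n} \<and> y \<le> x" if xy: "(f \<circ>\<^sub>m g) x = Some y" for x y
  proof -
    obtain z where z: "g x = Some z" "f z = Some y"
      using xy by (auto simp: map_comp_Some_iff)
    have "x \<in> {1..n}" "z \<le> x" using g z(1) by (auto simp: PF_def)
    moreover have "y \<in> {1..n}" "y \<le> z" using f z(2) ranI[of f z y] by (auto simp: PF_def)
    ultimately show ?thesis by auto
  qed
  then have "dom (f \<circ>\<^sub>m g) \<subseteq> {1..n}" "ran (f \<circ>\<^sub>m g) \<subseteq> {1..n}"
    "\<forall>x y. (f \<circ>\<^sub>m g) x = Some y \<longrightarrow> y \<le> x"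
    unfolding dom_def ran_def by blast+
  then show "f \<otimes>\<^bsub>PF n\<^esub> g \<in> carrier (PF n)"
    by (simp add: PF_def)
next
  show "\<one>\<^bsub>PF n\<^esub> \<in> carrier (PF n)"
    by (auto simp: PF_def restrict_map_def dom_def ran_def split: if_splits)
next
  fix f g h :: "nat \<rightharpoonup> nat"
  show "f \<otimes>\<^bsub>PF n\<^esub> g \<otimes>\<^bsub>PF n\<^esub> h = f \<otimes>\<^bsub>PF n\<^esub> (g \<otimes>\<^bsub>PF n\<^esub> h)"
    by (simp add: PF_def map_comp_def fun_eq_iff split: option.split)
next
  fix f assume f: "f \<in> carrier (PF n)"
  have ran: "y \<in> {1..n}" if "f x = Some y" for x y
    using f ranI[of f x y] that by (auto simp: PF_def)
  have dom: "f x = None" if "x \<notin> {1..n}" for x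
    using f that by (auto simp: PF_def)
  show "\<one>\<^bsub>PF n\<^esub> \<otimes>\<^bsub>PF n\<^esub> f = f"
  proof
    fix x show "(\<one>\<^bsub>PF n\<^esub> \<otimes>\<^bsub>PF n\<^esub> f) x = f x"
      using ran[of x] by (cases "f x") (simp_all add: PF_def map_comp_def restrict_map_def)
  qed
  show "f \<otimes>\<^bsub>PF n\<^esub> \<one>\<^bsub>PF n\<^esub> = f"
  proof
    fix x show "(f \<otimes>\<^bsub>PF n\<^esub> \<one>\<^bsub>PF n\<^esub>) x = f x"
      using dom[of x] by (cases "x \<in> {1..n}") (simp_all add: PF_def map_comp_def restrict_map_def)
  qed
qed

lemma is_monoid_zero_PF: "is_monoid_zero (PF n) Map.empty"
  by (auto simp: is_monoid_zero_def PF_def map_comp_def fun_eq_iff split: option.splits)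

end

(*
  For a finite monoid M with zero z, sending a to (sum of the coefficients of a, a mod z) is an
  isomorphism K M = K x K_0 M.

  For connectedness of K_0 PF_n, pass from coefficients a(x) to the sums
  <a, above g> = sum of a(x) over all x extending g, for g nonempty. These determine a modulo the
  empty function (Moebius inversion), and they identify K_0 PF_n with the algebra of the category
  of order-decreasing surjections between nonempty subsets of {1..n}. In that category every
  endomorphism is an identity, so a central element is supported on identities, and every object X
  maps to {1}, so the coefficients at all the identities agree. A central idempotent is therefore
  c * 1 with c^2 = c. Commutation is only ever tested against basis elements, so the category
  itself is not needed.
*)
theory Submission
  imports Defs
begin

section \<open>Algebras over a field: the base field, products and quotients\<close>

text \<open>Extending a ring record by a scalar multiplication changes its type, so the ring axioms
  have to be carried over. This is done for \<open>base_algebra\<close> and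
  \<open>quotient_algebra\<close>.\<close>

lemma ring_cong:
  assumes "ring R" "carrier S = carrier R" "mult S = mult R" "one S = one R"
    "zero S = zero R" "add S = add R"
  shows "ring S"
proof -
  interpret ring R by fact
  show ?thesis
    by (intro ringI abelian_groupI monoidI)
      (auto simp: assms(2-) ring_simprules intro: bexI[of _ "\<ominus>\<^bsub>R\<^esub> x" for x])
qed

lemma base_algebra_simps [simp]:
  "carrier (base_algebra K) = carrier K" "mult (base_algebra K) = mult K"
  "one (base_algebra K) = one K" "zero (base_algebra K) = zero K"
  "add (base_algebra K) = add K" "smult (base_algebra K) = mult K"
  by (simp_all add: base_algebra_def ring.defs monoid.defs)

lemma connected_base_algebra:
  assumes "field K"
  shows "connected_algebra K (base_algebra K)"
proof -
  interpret field K by fact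
  have ring: "ring (base_algebra K)"
    by (rule ring_cong[OF ring_axioms]) simp_all
  then have "module K (base_algebra K)"
    by (intro moduleI) (auto simp: ring.is_abelian_group cring_axioms ring_simprules m_assoc)
  then have "unital_algebra K (base_algebra K)"
    using ring by (auto simp: unital_algebra_def m_assoc m_lcomm)
  \<comment> \<open>A nonzero \<open>x\<close> can be cancelled from x x = x 1.\<close>
  moreover have "x = \<zero>\<^bsub>K\<^esub> \<or> x = \<one>\<^bsub>K\<^esub>" if x: "x \<in> carrier K" "x \<otimes>\<^bsub>K\<^esub> x = x" for x
    using m_lcancel[of x x "\<one>\<^bsub>K\<^esub>"] x by auto
  ultimately show ?thesis
    by (auto simp: connected_algebra_def central_idempotents_def)
qed

lemma quotient_algebra_simps [simp]:
  "carrier (quotient_algebra A I) = carrier (A Quot I)"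
  "mult (quotient_algebra A I) = mult (A Quot I)"
  "one (quotient_algebra A I) = one (A Quot I)"
  "zero (quotient_algebra A I) = zero (A Quot I)"
  "add (quotient_algebra A I) = add (A Quot I)"
  by (simp_all add: quotient_algebra_def ring.defs monoid.defs)

lemma product_algebra_simps [simp]:
  "carrier (product_algebra A B) = carrier A \<times> carrier B"
  "mult (product_algebra A B) (a, b) (a', b') = (a \<otimes>\<^bsub>A\<^esub> a', b \<otimes>\<^bsub>B\<^esub> b')"
  "one (product_algebra A B) = (one A, one B)"
  "zero (product_algebra A B) = (zero A, zero B)"
  "add (product_algebra A B) (a, b) (a', b') = (a \<oplus>\<^bsub>A\<^esub> a', b \<oplus>\<^bsub>B\<^esub> b')"
  "smult (product_algebra A B) c (a, b) = (c \<odot>\<^bsub>A\<^esub> a, c \<odot>\<^bsub>B\<^esub> b)"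
  by (simp_all add: product_algebra_def RDirProd_def DirProd_def ring.defs monoid.defs)

text \<open>The action on a coset is a union over all its representatives. Stability of
  \<open>I\<close> under scalars puts all their multiples into one coset, so the sets in the union
  coincide; \<open>a\<close> itself shows that the union is not over an empty set.\<close>

lemma smult_quotient_algebra:
  assumes "module K A" and "ideal I A" and stable: "\<And>c x. c \<in> carrier K \<Longrightarrow> x \<in> I \<Longrightarrow> c \<odot>\<^bsub>A\<^esub> x \<in> I"
    and c: "c \<in> carrier K" and a: "a \<in> carrier A"
  shows "c \<odot>\<^bsub>quotient_algebra A I\<^esub> (I +>\<^bsub>A\<^esub> a) = I +>\<^bsub>A\<^esub> (c \<odot>\<^bsub>A\<^esub> a)"
proof -
  interpret module K A by fact
  interpret ideal I A by fact
  have "I +>\<^bsub>A\<^esub> (c \<odot>\<^bsub>A\<^esub> x) = I +>\<^bsub>A\<^esub> (c \<odot>\<^bsub>A\<^esub> a)" if x: "x \<in> I +>\<^bsub>A\<^esub> a" for x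
  proof -
    obtain i where i: "i \<in> I" "x = i \<oplus>\<^bsub>A\<^esub> a"
      using x by (auto simp: a_r_coset_def r_coset_def)
    then have "c \<odot>\<^bsub>A\<^esub> x = c \<odot>\<^bsub>A\<^esub> i \<oplus>\<^bsub>A\<^esub> c \<odot>\<^bsub>A\<^esub> a"
      using c a a_Hcarr by (simp add: smult_r_distr)
    then have "c \<odot>\<^bsub>A\<^esub> x \<in> I +>\<^bsub>A\<^esub> (c \<odot>\<^bsub>A\<^esub> a)"
      using stable[OF c i(1)] by (auto simp: a_r_coset_def r_coset_def)
    then show ?thesis
      using a_repr_independence'[of "c \<odot>\<^bsub>A\<^esub> x" "c \<odot>\<^bsub>A\<^esub> a"] c a by simp
  qed
  then show ?thesis
    using a_rcos_self[OF a] unfolding quotient_algebra_def ring.defs module.simps by blast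
qed

lemma unital_algebra_quotient:
  assumes A: "unital_algebra K A" and "ideal I A"
    and stable: "\<And>c x. c \<in> carrier K \<Longrightarrow> x \<in> I \<Longrightarrow> c \<odot>\<^bsub>A\<^esub> x \<in> I"
  shows "unital_algebra K (quotient_algebra A I)"
proof -
  have mod: "module K A" using A by (simp add: unital_algebra_def)
  interpret module K A by fact
  interpret ideal I A by fact
  note smult = smult_quotient_algebra[OF mod \<open>ideal I A\<close> stable]
  have carrier: "carrier (A Quot I) = (\<lambda>a. I +>\<^bsub>A\<^esub> a) ` carrier A"
    by (auto simp: FactRing_simps)
  have coset: "mult (A Quot I) (I +>\<^bsub>A\<^esub> a) (I +>\<^bsub>A\<^esub> b) = I +>\<^bsub>A\<^esub> (a \<otimes>\<^bsub>A\<^esub> b)"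
    "add (A Quot I) (I +>\<^bsub>A\<^esub> a) (I +>\<^bsub>A\<^esub> b) = I +>\<^bsub>A\<^esub> (a \<oplus>\<^bsub>A\<^esub> b)"
    if "a \<in> carrier A" "b \<in> carrier A" for a b
    using that by (simp_all add: FactRing_def rcoset_mult_add a_rcos_sum)
  have ring: "ring (quotient_algebra A I)"
    by (rule ring_cong[OF quotient_is_ring]) simp_all
  then have "module K (quotient_algebra A I)"
    by (intro moduleI)
      (auto simp: ring.is_abelian_group R.cring_axioms carrier coset smult
        smult_l_distr smult_r_distr smult_assoc1)
  with ring show ?thesis
    using A by (auto simp: unital_algebra_def carrier coset smult)
qed


section \<open>Double finite sums\<close>

lemma (in abelian_monoid) finsum_swap:
  assumes "finite A" "finite B" "\<And>x y. x \<in> A \<Longrightarrow> y \<in> B \<Longrightarrow> f x y \<in> carrier G"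
  shows "(\<Oplus>x\<in>A. \<Oplus>y\<in>B. f x y) = (\<Oplus>y\<in>B. \<Oplus>x\<in>A. f x y)"
  using assms(1,3)
proof (induction A rule: finite_induct)
  case (insert a A)
  have "(\<Oplus>y\<in>B. \<Oplus>x\<in>insert a A. f x y) = (\<Oplus>y\<in>B. f a y \<oplus> (\<Oplus>x\<in>A. f x y))"
    using insert by (intro finsum_cong') (auto simp: Pi_iff)
  also have "\<dots> = (\<Oplus>y\<in>B. f a y) \<oplus> (\<Oplus>y\<in>B. \<Oplus>x\<in>A. f x y)"
    using insert by (intro finsum_addf) (auto simp: Pi_iff)
  finally show ?case
    using insert by (simp add: Pi_iff)
qed simp

lemma (in abelian_monoid) finsum_Times:
  assumes "finite A" "finite B" "\<And>x y. x \<in> A \<Longrightarrow> y \<in> B \<Longrightarrow> f (x, y) \<in> carrier G"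
  shows "finsum G f (A \<times> B) = (\<Oplus>x\<in>A. \<Oplus>y\<in>B. f (x, y))"
  using assms(1,3)
proof (induction A rule: finite_induct)
  case (insert a A)
  have "finsum G f (insert a A \<times> B) = finsum G f (Pair a ` B \<union> A \<times> B)"
    by (rule arg_cong[where f = "finsum G f"]) auto
  also have "\<dots> = finsum G f (Pair a ` B) \<oplus> finsum G f (A \<times> B)"
    using insert assms(2) by (intro finsum_Un_disjoint) auto
  also have "finsum G f (Pair a ` B) = (\<Oplus>y\<in>B. f (a, y))"
    using insert by (intro finsum_reindex) (auto simp: inj_on_def)
  finally show ?case
    using insert by (simp add: Pi_iff)
qed simp

section \<open>The algebra of a finite monoid\<close>

text \<open>Finiteness makes the support condition automatic: elements of the algebra are arbitrary
  coefficient functions, and all sums may run over the whole carrier.\<close>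

locale finite_monoid_algebra = cring K + mon: monoid M
  for K :: "('k, 'p) ring_scheme" (structure) and M :: "('m, 'q) monoid_scheme" +
  assumes finite_carrier [simp]: "finite (carrier M)"
begin

abbreviation A :: "('k, 'm \<Rightarrow> 'k) module" where
  "A \<equiv> monoid_algebra K M"

abbreviation \<delta> :: "'m \<Rightarrow> 'm \<Rightarrow> 'k" where
  "\<delta> \<equiv> basis_element K M"

text \<open>The linear extension of \<open>F\<close> to the algebra, evaluated at \<open>f\<close>.
  Coefficients of products, the augmentation and the sums over extensions of a map are all of this
  form, so one set of rules serves for all of them.\<close>

definition pairing :: "('m \<Rightarrow> 'k) \<Rightarrow> ('m \<Rightarrow> 'k) \<Rightarrow> 'k" where
  "pairing f F = (\<Oplus>m\<in>carrier M. f m \<otimes> F m)"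

lemma carrier_A: "carrier A = carrier M \<rightarrow>\<^sub>E carrier K"
  by (simp add: monoid_algebra_def)

lemma A_apply [simp]:
  assumes "m \<in> carrier M"
  shows "one A m = \<delta> (one M) m" "zero A m = \<zero>" "(f \<oplus>\<^bsub>A\<^esub> g) m = f m \<oplus> g m"
    "(c \<odot>\<^bsub>A\<^esub> f) m = c \<otimes> f m"
  using assms by (simp_all add: monoid_algebra_def)

lemma in_carrier_A [simp, intro]: "f \<in> carrier A \<Longrightarrow> m \<in> carrier M \<Longrightarrow> f m \<in> carrier K"
  by (auto simp: carrier_A)

lemma A_eqI: "f \<in> carrier A \<Longrightarrow> g \<in> carrier A \<Longrightarrow> (\<And>m. m \<in> carrier M \<Longrightarrow> f m = g m) \<Longrightarrow> f = g"
  by (auto simp: carrier_A intro: PiE_ext)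

lemma basis_element_apply: "m \<in> carrier M \<Longrightarrow> \<delta> b m = (if m = b then \<one> else \<zero>)"
  by (simp add: basis_element_def)

lemma basis_element_in_A [simp, intro]: "\<delta> b \<in> carrier A"
  by (auto simp: carrier_A basis_element_def)

lemma basis_element_closed [simp, intro]: "m \<in> carrier M \<Longrightarrow> \<delta> b m \<in> carrier K"
  by (rule in_carrier_A[OF basis_element_in_A])

lemma pairing_closed [simp, intro]:
  assumes "\<And>m. m \<in> carrier M \<Longrightarrow> f m \<in> carrier K" "\<And>m. m \<in> carrier M \<Longrightarrow> F m \<in> carrier K"
  shows "pairing f F \<in> carrier K"
  using assms by (simp add: pairing_def Pi_iff)

text \<open>Only the products are compared, so \<open>F\<close> and \<open>G\<close> may differ
  where the coefficients vanish, and \<open>f\<close> and \<open>g\<close> where the functionals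
  do.\<close>

lemma pairing_cong:
  assumes "\<And>m. m \<in> carrier M \<Longrightarrow> g m \<in> carrier K" "\<And>m. m \<in> carrier M \<Longrightarrow> G m \<in> carrier K"
    and "\<And>m. m \<in> carrier M \<Longrightarrow> f m \<otimes> F m = g m \<otimes> G m"
  shows "pairing f F = pairing g G"
  unfolding pairing_def using assms by (intro finsum_cong') auto

lemma pairing_cong_right:
  assumes "\<And>m. m \<in> carrier M \<Longrightarrow> f m \<in> carrier K" "\<And>m. m \<in> carrier M \<Longrightarrow> G m \<in> carrier K"
    and "\<And>m. m \<in> carrier M \<Longrightarrow> F m = G m"
  shows "pairing f F = pairing f G"
  using assms by (intro pairing_cong) auto

lemma pairing_eq_zero:
  assumes "\<And>m. m \<in> carrier M \<Longrightarrow> f m \<otimes> F m = \<zero>"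
  shows "pairing f F = \<zero>"
  unfolding pairing_def using assms by (intro add.finprod_one_eqI) auto

lemma pairing_add_left:
  assumes "\<And>m. m \<in> carrier M \<Longrightarrow> f m \<in> carrier K" "\<And>m. m \<in> carrier M \<Longrightarrow> g m \<in> carrier K"
    and "\<And>m. m \<in> carrier M \<Longrightarrow> F m \<in> carrier K"
    and "\<And>m. m \<in> carrier M \<Longrightarrow> h m = f m \<oplus> g m"
  shows "pairing h F = pairing f F \<oplus> pairing g F"
proof -
  have "pairing h F = (\<Oplus>m\<in>carrier M. f m \<otimes> F m \<oplus> g m \<otimes> F m)"
    unfolding pairing_def using assms by (intro finsum_cong') (auto simp: l_distr)
  then show ?thesis
    unfolding pairing_def using assms by (simp add: finsum_addf Pi_iff)
qed

lemma pairing_commute: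
  assumes "\<And>m. m \<in> carrier M \<Longrightarrow> f m \<in> carrier K" "\<And>m. m \<in> carrier M \<Longrightarrow> F m \<in> carrier K"
  shows "pairing f F = pairing F f"
  using assms by (intro pairing_cong) (auto simp: m_comm)

lemma pairing_smult_left:
  assumes "\<And>m. m \<in> carrier M \<Longrightarrow> f m \<in> carrier K" "\<And>m. m \<in> carrier M \<Longrightarrow> F m \<in> carrier K"
    and "c \<in> carrier K" and "\<And>m. m \<in> carrier M \<Longrightarrow> h m = c \<otimes> f m"
  shows "pairing h F = c \<otimes> pairing f F"
  unfolding pairing_def using assms
  by (subst finsum_rdistr) (auto simp: Pi_iff m_assoc intro!: finsum_cong')

lemma pairing_add_right:
  assumes "\<And>m. m \<in> carrier M \<Longrightarrow> f m \<in> carrier K"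
    and "\<And>m. m \<in> carrier M \<Longrightarrow> F m \<in> carrier K" "\<And>m. m \<in> carrier M \<Longrightarrow> G m \<in> carrier K"
    and "\<And>m. m \<in> carrier M \<Longrightarrow> H m = F m \<oplus> G m"
  shows "pairing f H = pairing f F \<oplus> pairing f G"
  using assms pairing_add_left[of F G f H] by (simp add: pairing_commute[of f])

lemma pairing_smult_right:
  assumes "\<And>m. m \<in> carrier M \<Longrightarrow> f m \<in> carrier K" "\<And>m. m \<in> carrier M \<Longrightarrow> F m \<in> carrier K"
    and "c \<in> carrier K" and "\<And>m. m \<in> carrier M \<Longrightarrow> H m = c \<otimes> F m"
  shows "pairing f H = c \<otimes> pairing f F"
  using assms pairing_smult_left[of F f c H] by (simp add: pairing_commute[of f])

lemma pairing_basis_element [simp]: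
  assumes "b \<in> carrier M" "\<And>m. m \<in> carrier M \<Longrightarrow> F m \<in> carrier K"
  shows "pairing (\<delta> b) F = F b"
proof -
  have "pairing (\<delta> b) F = (\<Oplus>m\<in>carrier M. if m = b then F m else \<zero>)"
    unfolding pairing_def using assms by (intro finsum_cong') (auto simp: basis_element_apply)
  then show ?thesis
    using assms by (simp add: add.finprod_singleton_swap Pi_iff)
qed

text \<open>Interchange of two finite sums, in the form that moves an inner sum out of the
  coefficient argument.\<close>

lemma pairing_swap:
  assumes "\<And>x. x \<in> carrier M \<Longrightarrow> f x \<in> carrier K" "\<And>m. m \<in> carrier M \<Longrightarrow> F m \<in> carrier K"
    and "\<And>x m. x \<in> carrier M \<Longrightarrow> m \<in> carrier M \<Longrightarrow> G x m \<in> carrier K"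
  shows "pairing (\<lambda>m. pairing f (\<lambda>x. G x m)) F = pairing f (\<lambda>x. pairing (G x) F)"
proof -
  have "pairing (\<lambda>m. pairing f (\<lambda>x. G x m)) F
      = (\<Oplus>m\<in>carrier M. \<Oplus>x\<in>carrier M. f x \<otimes> G x m \<otimes> F m)"
    unfolding pairing_def using assms by (intro finsum_cong' finsum_ldistr) auto
  also have "\<dots> = (\<Oplus>x\<in>carrier M. \<Oplus>m\<in>carrier M. f x \<otimes> G x m \<otimes> F m)"
    using assms by (intro finsum_swap) auto
  also have "\<dots> = (\<Oplus>x\<in>carrier M. \<Oplus>m\<in>carrier M. f x \<otimes> (G x m \<otimes> F m))"
    using assms by (intro finsum_cong') (auto simp: m_assoc)
  also have "\<dots> = pairing f (\<lambda>x. pairing (G x) F)"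
    unfolding pairing_def using assms by (intro finsum_cong' finsum_rdistr[symmetric]) auto
  finally show ?thesis .
qed

text \<open>The index set in the definition of the product leaves out only pairs with a vanishing
  coefficient or with a product other than \<open>m\<close>. Once the indicator \<delta> is
  inserted, these pairs contribute zero, so the sum can be taken over all pairs.\<close>

lemma mult_apply:
  assumes f: "f \<in> carrier A" and g: "g \<in> carrier A" and m: "m \<in> carrier M"
  shows "(f \<otimes>\<^bsub>A\<^esub> g) m = pairing f (\<lambda>x. pairing g (\<lambda>y. \<delta> (x \<otimes>\<^bsub>M\<^esub> y) m))"
proof -
  let ?h = "\<lambda>(x, y). f x \<otimes> (g y \<otimes> \<delta> (x \<otimes>\<^bsub>M\<^esub> y) m)"
  have "(f \<otimes>\<^bsub>A\<^esub> g) m = finsum K (\<lambda>(x, y). f x \<otimes> g y)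
      {(x, y) \<in> carrier M \<times> carrier M. f x \<noteq> \<zero> \<and> g y \<noteq> \<zero> \<and> x \<otimes>\<^bsub>M\<^esub> y = m}"
    using m by (simp add: monoid_algebra_def)
  also have "\<dots> = finsum K ?h (carrier M \<times> carrier M)"
    using f g m
    by (intro add.finprod_mono_neutral_cong_left) (auto simp: basis_element_apply split: if_splits)
  also have "\<dots> = (\<Oplus>x\<in>carrier M. \<Oplus>y\<in>carrier M. f x \<otimes> (g y \<otimes> \<delta> (x \<otimes>\<^bsub>M\<^esub> y) m))"
    using f g m by (subst finsum_Times) auto
  also have "\<dots> = pairing f (\<lambda>x. pairing g (\<lambda>y. \<delta> (x \<otimes>\<^bsub>M\<^esub> y) m))"
    unfolding pairing_def using f g m by (intro finsum_cong' finsum_rdistr[symmetric]) auto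
  finally show ?thesis .
qed

text \<open>After substituting the coefficient formula, the sum over \<open>m\<close> is moved
  inside both other sums, where \<delta> collapses it to the value of \<open>F\<close> at the
  product. From here on products are evaluated by functionals, without index sets.\<close>

lemma pairing_mult:
  assumes f: "f \<in> carrier A" and g: "g \<in> carrier A"
    and F: "\<And>m. m \<in> carrier M \<Longrightarrow> F m \<in> carrier K"
  shows "pairing (f \<otimes>\<^bsub>A\<^esub> g) F = pairing f (\<lambda>x. pairing g (\<lambda>y. F (x \<otimes>\<^bsub>M\<^esub> y)))"
proof -
  have "pairing (f \<otimes>\<^bsub>A\<^esub> g) F
      = pairing (\<lambda>m. pairing f (\<lambda>x. pairing g (\<lambda>y. \<delta> (x \<otimes>\<^bsub>M\<^esub> y) m))) F"
    using assms by (intro pairing_cong) (auto simp: mult_apply)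
  also have "\<dots> = pairing f (\<lambda>x. pairing (\<lambda>m. pairing g (\<lambda>y. \<delta> (x \<otimes>\<^bsub>M\<^esub> y) m)) F)"
    using assms by (intro pairing_swap) auto
  also have "\<dots> = pairing f (\<lambda>x. pairing g (\<lambda>y. pairing (\<delta> (x \<otimes>\<^bsub>M\<^esub> y)) F))"
    using assms by (intro pairing_cong_right pairing_swap) auto
  also have "\<dots> = pairing f (\<lambda>x. pairing g (\<lambda>y. F (x \<otimes>\<^bsub>M\<^esub> y)))"
    using assms by (intro pairing_cong_right pairing_basis_element) auto
  finally show ?thesis .
qed

text \<open>The double sum of F x F y factors. Applied below to the augmentation and to the
  indicator of the maps fixing 1.\<close>

lemma pairing_mult_multiplicative:
  assumes f: "f \<in> carrier A" and g: "g \<in> carrier A"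
    and F: "\<And>m. m \<in> carrier M \<Longrightarrow> F m \<in> carrier K"
    and mult: "\<And>x y. x \<in> carrier M \<Longrightarrow> y \<in> carrier M \<Longrightarrow> F (x \<otimes>\<^bsub>M\<^esub> y) = F x \<otimes> F y"
  shows "pairing (f \<otimes>\<^bsub>A\<^esub> g) F = pairing f F \<otimes> pairing g F"
proof -
  have "pairing g (\<lambda>y. F (x \<otimes>\<^bsub>M\<^esub> y)) = F x \<otimes> pairing g F" if "x \<in> carrier M" for x
    using assms that by (intro pairing_smult_right) auto
  then have "pairing (f \<otimes>\<^bsub>A\<^esub> g) F = pairing f (\<lambda>x. F x \<otimes> pairing g F)"
    using assms by (simp add: pairing_mult) (rule pairing_cong_right, auto)
  also have "\<dots> = pairing g F \<otimes> pairing f F"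
    using assms by (intro pairing_smult_right) (auto simp: m_comm)
  finally show ?thesis
    using assms by (simp add: m_comm)
qed

text \<open>Multiplication by a basis element translates the argument of the functional. This turns
  centrality into identities between sums of coefficients of \<open>e\<close>.\<close>

lemma pairing_mult_basis_element:
  assumes e: "e \<in> carrier A" and b: "b \<in> carrier M"
    and F: "\<And>m. m \<in> carrier M \<Longrightarrow> F m \<in> carrier K"
  shows "pairing (e \<otimes>\<^bsub>A\<^esub> \<delta> b) F = pairing e (\<lambda>x. F (x \<otimes>\<^bsub>M\<^esub> b))"
    and "pairing (\<delta> b \<otimes>\<^bsub>A\<^esub> e) F = pairing e (\<lambda>x. F (b \<otimes>\<^bsub>M\<^esub> x))"
proof -
  show "pairing (e \<otimes>\<^bsub>A\<^esub> \<delta> b) F = pairing e (\<lambda>x. F (x \<otimes>\<^bsub>M\<^esub> b))"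
    using assms by (simp add: pairing_mult) (rule pairing_cong_right, auto)
  show "pairing (\<delta> b \<otimes>\<^bsub>A\<^esub> e) F = pairing e (\<lambda>x. F (b \<otimes>\<^bsub>M\<^esub> x))"
    using assms by (simp add: pairing_mult)
qed

lemma zero_in_A [simp]: "zero A \<in> carrier A"
  and one_in_A [simp]: "one A \<in> carrier A"
  by (auto simp: monoid_algebra_def carrier_A basis_element_def)

lemma add_in_A [simp]: "f \<in> carrier A \<Longrightarrow> g \<in> carrier A \<Longrightarrow> f \<oplus>\<^bsub>A\<^esub> g \<in> carrier A"
  and smult_in_A [simp]: "c \<in> carrier K \<Longrightarrow> f \<in> carrier A \<Longrightarrow> c \<odot>\<^bsub>A\<^esub> f \<in> carrier A"
  by (auto simp: monoid_algebra_def carrier_A)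

lemma mult_in_A [simp]:
  assumes "f \<in> carrier A" "g \<in> carrier A"
  shows "f \<otimes>\<^bsub>A\<^esub> g \<in> carrier A"
proof -
  have "(f \<otimes>\<^bsub>A\<^esub> g) m \<in> carrier K" if "m \<in> carrier M" for m
    using assms that by (auto simp only: mult_apply intro!: pairing_closed)
  moreover have "f \<otimes>\<^bsub>A\<^esub> g \<in> extensional (carrier M)"
    by (simp add: monoid_algebra_def)
  ultimately show ?thesis
    unfolding carrier_A PiE_def by blast
qed

lemma abelian_group_A: "abelian_group A"
proof (rule abelian_groupI)
  fix f assume f: "f \<in> carrier A"
  have "(\<lambda>m\<in>carrier M. \<ominus> f m) \<in> carrier A"
    using f by (auto simp: carrier_A)
  then show "\<exists>g\<in>carrier A. g \<oplus>\<^bsub>A\<^esub> f = zero A"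
    using f by (intro bexI[of _ "\<lambda>m\<in>carrier M. \<ominus> f m"]) (auto intro!: A_eqI simp: l_neg)
qed (auto intro!: A_eqI simp: a_ac)

lemma monoid_A: "monoid A"
proof (rule monoidI)
  fix f g h assume fgh: "f \<in> carrier A" "g \<in> carrier A" "h \<in> carrier A"
  show "f \<otimes>\<^bsub>A\<^esub> g \<otimes>\<^bsub>A\<^esub> h = f \<otimes>\<^bsub>A\<^esub> (g \<otimes>\<^bsub>A\<^esub> h)"
  proof (rule A_eqI)
    fix m assume m: "m \<in> carrier M"
    \<comment> \<open>Both bracketings are reduced to the same triple sum over x, y, z, where
      associativity in \<open>M\<close> applies.\<close>
    have "(f \<otimes>\<^bsub>A\<^esub> g \<otimes>\<^bsub>A\<^esub> h) m
        = pairing f (\<lambda>x. pairing g (\<lambda>y. pairing h (\<lambda>z. \<delta> (x \<otimes>\<^bsub>M\<^esub> y \<otimes>\<^bsub>M\<^esub> z) m)))"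
      using fgh m by (subst mult_apply) (auto intro: pairing_mult)
    also have "\<dots> = pairing f (\<lambda>x. pairing g (\<lambda>y. pairing h (\<lambda>z. \<delta> (x \<otimes>\<^bsub>M\<^esub> (y \<otimes>\<^bsub>M\<^esub> z)) m)))"
      using fgh m by (intro pairing_cong_right) (auto simp: mon.m_assoc)
    also have "\<dots> = pairing f (\<lambda>x. pairing (g \<otimes>\<^bsub>A\<^esub> h) (\<lambda>v. \<delta> (x \<otimes>\<^bsub>M\<^esub> v) m))"
    proof (rule pairing_cong_right)
      fix x assume x: "x \<in> carrier M"
      show "pairing g (\<lambda>y. pairing h (\<lambda>z. \<delta> (x \<otimes>\<^bsub>M\<^esub> (y \<otimes>\<^bsub>M\<^esub> z)) m))
          = pairing (g \<otimes>\<^bsub>A\<^esub> h) (\<lambda>v. \<delta> (x \<otimes>\<^bsub>M\<^esub> v) m)"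
        using fgh m x by (simp add: pairing_mult[where F = "\<lambda>v. \<delta> (x \<otimes>\<^bsub>M\<^esub> v) m"])
    qed (use fgh m in auto)
    also have "\<dots> = (f \<otimes>\<^bsub>A\<^esub> (g \<otimes>\<^bsub>A\<^esub> h)) m"
      using fgh m by (subst mult_apply) auto
    finally show "(f \<otimes>\<^bsub>A\<^esub> g \<otimes>\<^bsub>A\<^esub> h) m = (f \<otimes>\<^bsub>A\<^esub> (g \<otimes>\<^bsub>A\<^esub> h)) m" .
  qed (use fgh in auto)
next
  fix f assume f: "f \<in> carrier A"
  have one: "one A = \<delta> (one M)"
    by (simp add: monoid_algebra_def)
  \<comment> \<open>\<delta> is symmetric in its two arguments, so this is the pairing with the
    basis element of \<open>m\<close>, the factors exchanged.\<close>
  have delta: "pairing f (\<lambda>x. \<delta> x m) = f m" if "m \<in> carrier M" for m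
  proof -
    have "pairing f (\<lambda>x. \<delta> x m) = pairing (\<delta> m) f"
      using f that by (intro pairing_cong) (auto simp: basis_element_apply)
    then show ?thesis using f that by simp
  qed
  show "one A \<otimes>\<^bsub>A\<^esub> f = f"
  proof (rule A_eqI)
    fix m assume m: "m \<in> carrier M"
    have "pairing f (\<lambda>y. \<delta> (\<one>\<^bsub>M\<^esub> \<otimes>\<^bsub>M\<^esub> y) m) = pairing f (\<lambda>x. \<delta> x m)"
      using f m by (intro pairing_cong) auto
    then show "(one A \<otimes>\<^bsub>A\<^esub> f) m = f m"
      using f m by (simp add: one mult_apply delta)
  qed (use f in auto)
  show "f \<otimes>\<^bsub>A\<^esub> one A = f"
  proof (rule A_eqI)
    fix m assume m: "m \<in> carrier M"
    have "pairing f (\<lambda>x. pairing (\<delta> \<one>\<^bsub>M\<^esub>) (\<lambda>y. \<delta> (x \<otimes>\<^bsub>M\<^esub> y) m)) = pairing f (\<lambda>x. \<delta> x m)"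
      using f m by (intro pairing_cong) auto
    then show "(f \<otimes>\<^bsub>A\<^esub> one A) m = f m"
      using f m by (simp add: one mult_apply delta)
  qed (use f in auto)
qed auto

lemma ring_A: "ring A"
proof (rule ringI[OF abelian_group_A monoid_A])
  fix f g h assume "f \<in> carrier A" "g \<in> carrier A" "h \<in> carrier A"
  note fgh = this
  show "(f \<oplus>\<^bsub>A\<^esub> g) \<otimes>\<^bsub>A\<^esub> h = f \<otimes>\<^bsub>A\<^esub> h \<oplus>\<^bsub>A\<^esub> g \<otimes>\<^bsub>A\<^esub> h"
  proof (rule A_eqI)
    fix m assume m: "m \<in> carrier M"
    show "((f \<oplus>\<^bsub>A\<^esub> g) \<otimes>\<^bsub>A\<^esub> h) m = (f \<otimes>\<^bsub>A\<^esub> h \<oplus>\<^bsub>A\<^esub> g \<otimes>\<^bsub>A\<^esub> h) m"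
      using fgh m by (simp add: mult_apply) (rule pairing_add_left, auto)
  qed (use fgh in auto)
  show "h \<otimes>\<^bsub>A\<^esub> (f \<oplus>\<^bsub>A\<^esub> g) = h \<otimes>\<^bsub>A\<^esub> f \<oplus>\<^bsub>A\<^esub> h \<otimes>\<^bsub>A\<^esub> g"
  proof (rule A_eqI)
    fix m assume m: "m \<in> carrier M"
    show "(h \<otimes>\<^bsub>A\<^esub> (f \<oplus>\<^bsub>A\<^esub> g)) m = (h \<otimes>\<^bsub>A\<^esub> f \<oplus>\<^bsub>A\<^esub> h \<otimes>\<^bsub>A\<^esub> g) m"
      using fgh m by (simp add: mult_apply) (rule pairing_add_right, auto intro: pairing_add_left)
  qed (use fgh in auto)
qed

lemma module_A: "module K A"
  by (rule moduleI[OF cring_axioms abelian_group_A])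
    (auto intro!: A_eqI simp: l_distr r_distr m_assoc)

lemma unital_algebra_A: "unital_algebra K A"
proof -
  have "(c \<odot>\<^bsub>A\<^esub> f) \<otimes>\<^bsub>A\<^esub> g = c \<odot>\<^bsub>A\<^esub> (f \<otimes>\<^bsub>A\<^esub> g)" "f \<otimes>\<^bsub>A\<^esub> (c \<odot>\<^bsub>A\<^esub> g) = c \<odot>\<^bsub>A\<^esub> (f \<otimes>\<^bsub>A\<^esub> g)"
    if cfg: "c \<in> carrier K" "f \<in> carrier A" "g \<in> carrier A" for c f g
  proof -
    show "(c \<odot>\<^bsub>A\<^esub> f) \<otimes>\<^bsub>A\<^esub> g = c \<odot>\<^bsub>A\<^esub> (f \<otimes>\<^bsub>A\<^esub> g)"
    proof (rule A_eqI)
      fix m assume m: "m \<in> carrier M"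
      show "((c \<odot>\<^bsub>A\<^esub> f) \<otimes>\<^bsub>A\<^esub> g) m = (c \<odot>\<^bsub>A\<^esub> (f \<otimes>\<^bsub>A\<^esub> g)) m"
        using cfg m by (simp add: mult_apply) (rule pairing_smult_left, auto)
    qed (use cfg in auto)
    show "f \<otimes>\<^bsub>A\<^esub> (c \<odot>\<^bsub>A\<^esub> g) = c \<odot>\<^bsub>A\<^esub> (f \<otimes>\<^bsub>A\<^esub> g)"
    proof (rule A_eqI)
      fix m assume m: "m \<in> carrier M"
      show "(f \<otimes>\<^bsub>A\<^esub> (c \<odot>\<^bsub>A\<^esub> g)) m = (c \<odot>\<^bsub>A\<^esub> (f \<otimes>\<^bsub>A\<^esub> g)) m"
        using cfg m by (simp add: mult_apply) (rule pairing_smult_right, auto intro: pairing_smult_left)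
    qed (use cfg in auto)
  qed
  then show ?thesis
    by (simp add: unital_algebra_def ring_A module_A)
qed


end

section \<open>Monoids with zero and the contracted algebra\<close>

locale finite_monoid_algebra_with_zero = finite_monoid_algebra K M
  for K :: "('k, 'p) ring_scheme" (structure) and M :: "('m, 'q) monoid_scheme" +
  fixes z :: 'm
  assumes zero: "is_monoid_zero M z"
begin

lemma z_closed [simp, intro]: "z \<in> carrier M"
  using zero by (simp add: is_monoid_zero_def)

lemma z_mult [simp]: "x \<in> carrier M \<Longrightarrow> z \<otimes>\<^bsub>M\<^esub> x = z" "x \<in> carrier M \<Longrightarrow> x \<otimes>\<^bsub>M\<^esub> z = z"
  using zero by (simp_all add: is_monoid_zero_def)

definition I :: "('m \<Rightarrow> 'k) set" where
  "I = {c \<odot>\<^bsub>A\<^esub> \<delta> z | c. c \<in> carrier K}"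

abbreviation A\<^sub>0 where "A\<^sub>0 \<equiv> contracted_monoid_algebra K M z"

lemma A\<^sub>0_eq: "A\<^sub>0 = quotient_algebra A I"
  by (simp add: contracted_monoid_algebra_def I_def)

text \<open>The scalar in front of the basis element of \<open>z\<close> can only be the coefficient
  \<open>f z\<close>.\<close>

lemma in_I_iff: "f \<in> I \<longleftrightarrow> f \<in> carrier A \<and> (\<forall>m\<in>carrier M. m \<noteq> z \<longrightarrow> f m = \<zero>)"
proof
  assume "f \<in> I"
  then show "f \<in> carrier A \<and> (\<forall>m\<in>carrier M. m \<noteq> z \<longrightarrow> f m = \<zero>)"
    by (auto simp: I_def basis_element_apply)
next
  assume f: "f \<in> carrier A \<and> (\<forall>m\<in>carrier M. m \<noteq> z \<longrightarrow> f m = \<zero>)"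
  then have "f = f z \<odot>\<^bsub>A\<^esub> \<delta> z"
    by (intro A_eqI) (auto simp: basis_element_apply)
  then show "f \<in> I"
    unfolding I_def using f by blast
qed

lemma ideal_I: "ideal I A"
proof (rule idealI[OF ring_A])
  interpret A: ring A by (rule ring_A)
  \<comment> \<open>The additive inverse in \<open>A\<close> is given only abstractly; uniqueness of
    inverses in \<open>K\<close> shows that it is taken coefficientwise.\<close>
  have inv: "(\<ominus>\<^bsub>A\<^esub> f) m = \<ominus> f m" if f: "f \<in> carrier A" and m: "m \<in> carrier M" for f m
  proof -
    have "(\<ominus>\<^bsub>A\<^esub> f) m \<oplus> f m = \<zero>"
      using A.l_neg[OF f] m by (metis A_apply(2,3))
    then show ?thesis
      using f m by (intro minus_equality[symmetric]) auto
  qed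
  have "zero A \<in> I"
    by (simp add: in_I_iff)
  then have "I \<noteq> {}"
    by blast
  then show "subgroup I (add_monoid A)"
    by (intro add.subgroupI A.add.subgroupI) (auto simp: in_I_iff inv)
  fix f g assume f: "f \<in> I" and g: "g \<in> carrier A"
  have fA: "f \<in> carrier A" using f by (simp add: in_I_iff)
  \<comment> \<open>Here \<open>w\<close> stands for a product with factor \<open>y\<close>. Since
    \<open>f\<close> is supported at \<open>z\<close> and products with \<open>z\<close> are
    \<open>z\<close>, no term reaches a coefficient other than the one at \<open>z\<close>.\<close>
  have *: "f y \<otimes> \<delta> w m = \<zero>"
    if "y \<in> carrier M" "m \<in> carrier M" "m \<noteq> z" "y = z \<Longrightarrow> w = z" for y w m
    using that f by (cases "y = z") (auto simp: in_I_iff basis_element_apply)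
  show "g \<otimes>\<^bsub>A\<^esub> f \<in> I"
    unfolding in_I_iff
  proof (intro conjI ballI impI)
    fix m assume m: "m \<in> carrier M" "m \<noteq> z"
    have "pairing f (\<lambda>y. \<delta> (x \<otimes>\<^bsub>M\<^esub> y) m) = \<zero>" if "x \<in> carrier M" for x
      using that m by (intro pairing_eq_zero *) auto
    then show "(g \<otimes>\<^bsub>A\<^esub> f) m = \<zero>"
      using g fA m by (simp add: mult_apply) (rule pairing_eq_zero, auto)
  qed (use fA g in auto)
  show "f \<otimes>\<^bsub>A\<^esub> g \<in> I"
    unfolding in_I_iff
  proof (intro conjI ballI impI)
    fix m assume m: "m \<in> carrier M" "m \<noteq> z"
    have "f x \<otimes> pairing g (\<lambda>y. \<delta> (x \<otimes>\<^bsub>M\<^esub> y) m) = \<zero>" if x: "x \<in> carrier M" for x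
    proof (cases "x = z")
      case True
      then have "pairing g (\<lambda>y. \<delta> (x \<otimes>\<^bsub>M\<^esub> y) m) = \<zero>"
        using g m by (intro pairing_eq_zero) (auto simp: basis_element_apply)
      then show ?thesis using fA x by simp
    next
      case False
      then show ?thesis using f g m x by (auto simp: in_I_iff)
    qed
    then show "(f \<otimes>\<^bsub>A\<^esub> g) m = \<zero>"
      using g fA m by (simp add: mult_apply) (rule pairing_eq_zero, auto)
  qed (use fA g in auto)
qed

sublocale I: ideal I A
  by (rule ideal_I)

lemma smult_I: "c \<in> carrier K \<Longrightarrow> f \<in> I \<Longrightarrow> c \<odot>\<^bsub>A\<^esub> f \<in> I"
  by (auto simp: in_I_iff)

text \<open>Membership in \<open>I\<close> says nothing about the coefficient at \<open>z\<close>
  and forces the others to vanish. Hence elements of the contracted algebra can be handled as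
  coefficient functions away from \<open>z\<close>.\<close>

lemma coset_eq_iff:
  assumes f: "f \<in> carrier A" and g: "g \<in> carrier A"
  shows "I +>\<^bsub>A\<^esub> f = I +>\<^bsub>A\<^esub> g \<longleftrightarrow> (\<forall>m\<in>carrier M. m \<noteq> z \<longrightarrow> f m = g m)"
proof
  assume "I +>\<^bsub>A\<^esub> f = I +>\<^bsub>A\<^esub> g"
  then have "f \<in> I +>\<^bsub>A\<^esub> g"
    using I.a_rcos_self[OF f] by simp
  then obtain i where "i \<in> I" "f = i \<oplus>\<^bsub>A\<^esub> g"
    by (auto simp: a_r_coset_def r_coset_def)
  then show "\<forall>m\<in>carrier M. m \<noteq> z \<longrightarrow> f m = g m"
    using g by (auto simp: in_I_iff)
next
  assume eq: "\<forall>m\<in>carrier M. m \<noteq> z \<longrightarrow> f m = g m"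
  define i where "i = (f z \<ominus> g z) \<odot>\<^bsub>A\<^esub> \<delta> z"
  have i: "i \<in> I"
    unfolding I_def i_def using f g by auto
  have "f = i \<oplus>\<^bsub>A\<^esub> g"
  proof (rule A_eqI)
    fix m assume m: "m \<in> carrier M"
    show "f m = (i \<oplus>\<^bsub>A\<^esub> g) m"
      using f g m eq
      by (cases "m = z") (auto simp: i_def basis_element_apply a_minus_def a_assoc l_neg)
  qed (use f g i in \<open>auto simp: in_I_iff\<close>)
  then have "f \<in> I +>\<^bsub>A\<^esub> g"
    using i by (auto simp: a_r_coset_def r_coset_def)
  then show "I +>\<^bsub>A\<^esub> f = I +>\<^bsub>A\<^esub> g"
    using I.a_repr_independence'[of f g] g by simp
qed

lemma unital_algebra_A\<^sub>0: "unital_algebra K A\<^sub>0"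
  unfolding A\<^sub>0_eq by (rule unital_algebra_quotient[OF unital_algebra_A ideal_I smult_I])

lemma A\<^sub>0_simps:
  "carrier A\<^sub>0 = (\<lambda>f. I +>\<^bsub>A\<^esub> f) ` carrier A"
  "one A\<^sub>0 = I +>\<^bsub>A\<^esub> one A" "zero A\<^sub>0 = I +>\<^bsub>A\<^esub> zero A"
  "f \<in> carrier A \<Longrightarrow> g \<in> carrier A \<Longrightarrow> (I +>\<^bsub>A\<^esub> f) \<otimes>\<^bsub>A\<^sub>0\<^esub> (I +>\<^bsub>A\<^esub> g) = I +>\<^bsub>A\<^esub> (f \<otimes>\<^bsub>A\<^esub> g)"
  "f \<in> carrier A \<Longrightarrow> g \<in> carrier A \<Longrightarrow> (I +>\<^bsub>A\<^esub> f) \<oplus>\<^bsub>A\<^sub>0\<^esub> (I +>\<^bsub>A\<^esub> g) = I +>\<^bsub>A\<^esub> (f \<oplus>\<^bsub>A\<^esub> g)"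
  "c \<in> carrier K \<Longrightarrow> f \<in> carrier A \<Longrightarrow> c \<odot>\<^bsub>A\<^sub>0\<^esub> (I +>\<^bsub>A\<^esub> f) = I +>\<^bsub>A\<^esub> (c \<odot>\<^bsub>A\<^esub> f)"
  unfolding A\<^sub>0_eq
  using smult_quotient_algebra[OF module_A ideal_I smult_I, of c f]
    I.a_rcos_zero[OF ideal_I, of "zero A"]
  by (auto simp: FactRing_simps I.rcoset_mult_add I.a_rcos_sum in_I_iff)

text \<open>A central idempotent of the quotient is lifted to a representative \<open>e\<close>, for
  which centrality and idempotence hold only up to the coefficient at \<open>z\<close>. This leaves
  a question about coefficients alone.\<close>

lemma connected_A\<^sub>0I:
  assumes "\<And>e. e \<in> carrier A
      \<Longrightarrow> (\<And>f m. f \<in> carrier A \<Longrightarrow> m \<in> carrier M \<Longrightarrow> m \<noteq> z \<Longrightarrow> (e \<otimes>\<^bsub>A\<^esub> f) m = (f \<otimes>\<^bsub>A\<^esub> e) m)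
      \<Longrightarrow> (\<And>m. m \<in> carrier M \<Longrightarrow> m \<noteq> z \<Longrightarrow> (e \<otimes>\<^bsub>A\<^esub> e) m = e m)
      \<Longrightarrow> (\<forall>m\<in>carrier M. m \<noteq> z \<longrightarrow> e m = \<zero>) \<or> (\<forall>m\<in>carrier M. m \<noteq> z \<longrightarrow> e m = \<delta> \<one>\<^bsub>M\<^esub> m)"
  shows "connected_algebra K A\<^sub>0"
proof -
  interpret A\<^sub>0: ring A\<^sub>0
    using unital_algebra_A\<^sub>0 by (simp add: unital_algebra_def)
  have "E = zero A\<^sub>0 \<or> E = one A\<^sub>0" if E_ci: "E \<in> central_idempotents A\<^sub>0" for E
  proof -
    obtain e where e: "e \<in> carrier A" and E: "E = I +>\<^bsub>A\<^esub> e"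
      using E_ci by (auto simp: central_idempotents_def A\<^sub>0_simps)
    have "I +>\<^bsub>A\<^esub> (e \<otimes>\<^bsub>A\<^esub> f) = I +>\<^bsub>A\<^esub> (f \<otimes>\<^bsub>A\<^esub> e)" if "f \<in> carrier A" for f
      using E_ci that e
      by (auto simp: central_idempotents_def A\<^sub>0_simps E)
    then have comm: "(e \<otimes>\<^bsub>A\<^esub> f) m = (f \<otimes>\<^bsub>A\<^esub> e) m"
      if "f \<in> carrier A" "m \<in> carrier M" "m \<noteq> z" for f m
      using that e by (simp add: coset_eq_iff)
    have "I +>\<^bsub>A\<^esub> (e \<otimes>\<^bsub>A\<^esub> e) = I +>\<^bsub>A\<^esub> e"
      using E_ci e by (auto simp: central_idempotents_def A\<^sub>0_simps E)
    then have "(e \<otimes>\<^bsub>A\<^esub> e) m = e m" if "m \<in> carrier M" "m \<noteq> z" for m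
      using that e by (simp add: coset_eq_iff)
    from assms[OF e comm this] show ?thesis
      using e by (simp add: E A\<^sub>0_simps coset_eq_iff)
  qed
  then have "central_idempotents A\<^sub>0 = {zero A\<^sub>0, one A\<^sub>0}"
    by (auto simp: central_idempotents_def)
  then show ?thesis
    by (simp add: connected_algebra_def unital_algebra_A\<^sub>0)
qed

text \<open>A functional vanishing at \<open>z\<close> is well defined on the contracted
  algebra.\<close>

lemma pairing_cong_left:
  assumes "f \<in> carrier A" "g \<in> carrier A" "\<And>m. m \<in> carrier M \<Longrightarrow> m \<noteq> z \<Longrightarrow> f m = g m"
    and "\<And>m. m \<in> carrier M \<Longrightarrow> F m \<in> carrier K" and "F z = \<zero>"
  shows "pairing f F = pairing g F"
proof (rule pairing_cong)
  fix m assume "m \<in> carrier M"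
  then show "f m \<otimes> F m = g m \<otimes> F m"
    using assms by (cases "m = z") auto
qed (use assms in auto)

text \<open>A coset determines its elements up to multiples of the basis element of
  \<open>z\<close>. That basis element has augmentation 1, so prescribing the augmentation fixes the
  multiple.\<close>

lemma algebra_isomorphic_product:
  "algebra_isomorphic K A (product_algebra (base_algebra K) A\<^sub>0)"
proof -
  \<comment> \<open>The augmentation; it is multiplicative because the constant function 1
    is.\<close>
  define \<epsilon> where "\<epsilon> f = pairing f (\<lambda>_. \<one>)" for f
  define h where "h f = (\<epsilon> f, I +>\<^bsub>A\<^esub> f)" for f
  have \<epsilon>_closed [simp]: "\<epsilon> f \<in> carrier K" if "f \<in> carrier A" for f
    using that by (auto simp: \<epsilon>_def)
  have \<epsilon>_add [simp]: "\<epsilon> (f \<oplus>\<^bsub>A\<^esub> g) = \<epsilon> f \<oplus> \<epsilon> g" if "f \<in> carrier A" "g \<in> carrier A" for f g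
    unfolding \<epsilon>_def using that by (intro pairing_add_left) auto
  have \<epsilon>_smult [simp]: "\<epsilon> (c \<odot>\<^bsub>A\<^esub> f) = c \<otimes> \<epsilon> f" if "c \<in> carrier K" "f \<in> carrier A" for c f
    unfolding \<epsilon>_def using that by (intro pairing_smult_left) auto
  have \<epsilon>_mult [simp]: "\<epsilon> (f \<otimes>\<^bsub>A\<^esub> g) = \<epsilon> f \<otimes> \<epsilon> g" if "f \<in> carrier A" "g \<in> carrier A" for f g
    unfolding \<epsilon>_def using that by (intro pairing_mult_multiplicative) auto
  have \<epsilon>_basis [simp]: "\<epsilon> (\<delta> m) = \<one>" if "m \<in> carrier M" for m
    unfolding \<epsilon>_def using that by simp
  have one: "one A = \<delta> (one M)"
    by (simp add: monoid_algebra_def)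
  \<comment> \<open>Two elements of one coset differ by the multiple f z - g z of the basis element
    of \<open>z\<close>; applying \<epsilon> expresses this scalar by augmentations. Equal
    augmentations then give injectivity.\<close>
  have split: "f = g \<oplus>\<^bsub>A\<^esub> (\<epsilon> f \<ominus> \<epsilon> g) \<odot>\<^bsub>A\<^esub> \<delta> z"
    if f: "f \<in> carrier A" and g: "g \<in> carrier A" and eq: "I +>\<^bsub>A\<^esub> f = I +>\<^bsub>A\<^esub> g" for f g
  proof -
    have *: "f = g \<oplus>\<^bsub>A\<^esub> (f z \<ominus> g z) \<odot>\<^bsub>A\<^esub> \<delta> z"
    proof (rule A_eqI)
      fix m assume m: "m \<in> carrier M"
      show "f m = (g \<oplus>\<^bsub>A\<^esub> (f z \<ominus> g z) \<odot>\<^bsub>A\<^esub> \<delta> z) m"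
        using f g m eq
        by (cases "m = z") (auto simp: coset_eq_iff basis_element_apply a_minus_def a_lcomm r_neg)
    qed (use f g in auto)
    have "\<epsilon> f = \<epsilon> g \<oplus> (f z \<ominus> g z)"
      using f g by (subst *) simp
    then have "\<epsilon> f = (f z \<ominus> g z) \<oplus> \<epsilon> g"
      using f g by (simp add: a_comm)
    then have "\<epsilon> f \<ominus> \<epsilon> g = f z \<ominus> g z"
      using f g by (simp add: a_minus_def a_assoc r_neg)
    with * show ?thesis by simp
  qed
  have "inj_on h (carrier A)"
  proof (rule inj_onI)
    fix f g assume fg: "f \<in> carrier A" "g \<in> carrier A" "h f = h g"
    then have "f = g \<oplus>\<^bsub>A\<^esub> (\<epsilon> f \<ominus> \<epsilon> g) \<odot>\<^bsub>A\<^esub> \<delta> z"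
      by (intro split) (auto simp: h_def)
    also have "\<dots> = g"
      using fg by (intro A_eqI) (auto simp: h_def a_minus_def r_neg)
    finally show "f = g" .
  qed
  moreover have "(c, I +>\<^bsub>A\<^esub> f) \<in> h ` carrier A" if c: "c \<in> carrier K" and f: "f \<in> carrier A" for c f
  proof (rule image_eqI)
    \<comment> \<open>The correction brings the augmentation to \<open>c\<close> without leaving the
      coset of \<open>f\<close>.\<close>
    let ?g = "f \<oplus>\<^bsub>A\<^esub> (c \<ominus> \<epsilon> f) \<odot>\<^bsub>A\<^esub> \<delta> z"
    show "?g \<in> carrier A" using c f by simp
    have "\<epsilon> ?g = c"
      using c f by (simp add: a_minus_def a_lcomm r_neg)
    moreover have "I +>\<^bsub>A\<^esub> ?g = I +>\<^bsub>A\<^esub> f"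
      using c f by (subst coset_eq_iff) (auto simp: basis_element_apply)
    ultimately show "(c, I +>\<^bsub>A\<^esub> f) = h ?g"
      by (simp add: h_def)
  qed
  moreover have "h f \<in> carrier (product_algebra (base_algebra K) A\<^sub>0)" if "f \<in> carrier A" for f
    using that by (auto simp: h_def A\<^sub>0_simps)
  ultimately have "h \<in> ring_iso A (product_algebra (base_algebra K) A\<^sub>0)"
    by (intro ring_iso_memI) (auto simp: h_def A\<^sub>0_simps one bij_betw_def)
  moreover have "h (c \<odot>\<^bsub>A\<^esub> f) = c \<odot>\<^bsub>product_algebra (base_algebra K) A\<^sub>0\<^esub> h f"
    if "c \<in> carrier K" "f \<in> carrier A" for c f
    using that by (simp add: h_def A\<^sub>0_simps)
  ultimately show ?thesis
    unfolding algebra_isomorphic_def by blast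
qed

end


section \<open>Order-decreasing partial functions\<close>

lemma in_carrier_PF_iff:
  "f \<in> carrier (PF n) \<longleftrightarrow> (\<forall>x y. f x = Some y \<longrightarrow> 1 \<le> y \<and> y \<le> x \<and> x \<le> n)"
  by (fastforce simp: PF_def dom_def ran_def)

lemma finite_carrier_PF: "finite (carrier (PF n))"
proof (rule finite_subset)
  show "carrier (PF n) \<subseteq> (\<Union>X\<in>Pow {1..n}. {f. dom f = X \<and> ran f \<subseteq> {1..n}})"
    by (auto simp: PF_def)
  show "finite (\<Union>X\<in>Pow {1..n}. {f. dom f = X \<and> ran f \<subseteq> {1..n}})"
    by (intro finite_UN_I finite_set_of_finite_maps) (auto intro: finite_subset)
qed

text \<open>This is the fact that endomorphisms are identities. Induct downwards from
  \<open>n\<close>: a point y of the domain is g x for some x \<ge> y. If x > y, then x is already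
  known to be fixed, so g x = x, a contradiction.\<close>

lemma partial_identity_if_dom_subset_ran:
  assumes g: "g \<in> carrier (PF n)" and sub: "dom g \<subseteq> ran g"
  shows "g \<subseteq>\<^sub>m Some"
proof -
  have "g y = Some y" if "y \<in> dom g" for y
    using that
  proof (induction "n - y" arbitrary: y rule: less_induct)
    case less
    obtain x where x: "g x = Some y"
      using less.prems sub by (auto simp: ran_def)
    then have yx: "y \<le> x" "x \<le> n"
      using g by (auto simp: in_carrier_PF_iff)
    have "x = y"
    proof (rule ccontr)
      assume "x \<noteq> y"
      with yx have "g x = Some x"
        using x by (intro less.hyps) auto
      with x \<open>x \<noteq> y\<close> show False by simp
    qed
    with x show ?case by simp
  qed
  then show ?thesis
    by (auto simp: map_le_def)
qed

section \<open>Connectedness of the contracted algebra of \<open>PF n\<close>\<close>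

locale PF_algebra = field K
  for K :: "('k, 'p) ring_scheme" (structure) +
  fixes n :: nat
  assumes n: "n \<ge> 1"
begin

sublocale finite_monoid_algebra_with_zero K "PF n" Map.empty
  by (intro finite_monoid_algebra_with_zero.intro finite_monoid_algebra.intro monoid_PF
      finite_monoid_algebra_axioms.intro finite_monoid_algebra_with_zero_axioms.intro
      finite_carrier_PF is_monoid_zero_PF cring_axioms)

text \<open>The zeta function of the order by extension, with values in the field.\<close>

definition above :: "(nat \<rightharpoonup> nat) \<Rightarrow> (nat \<rightharpoonup> nat) \<Rightarrow> 'k" where
  "above g x = (if g \<subseteq>\<^sub>m x then \<one> else \<zero>)"

lemma above_closed [simp, intro]: "above g x \<in> carrier K"
  by (simp add: above_def)

lemma above_empty [simp]: "g \<noteq> Map.empty \<Longrightarrow> above g Map.empty = \<zero>"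
  by (auto simp: above_def map_le_def dom_def fun_eq_iff)

text \<open>Moebius inversion as an induction on the number of extensions of \<open>g\<close>:
  proper extensions have fewer extensions, so their coefficients already agree, and the sums for
  \<open>g\<close> differ at most in the term at \<open>g\<close>. As \<open>U\<close> is closed
  under extension, the induction stays in \<open>U\<close>; this allows inversion on the nonempty
  maps, or on those that are not partial identities.\<close>

lemma eq_if_pairing_above_eq:
  assumes a: "a \<in> carrier A" and b: "b \<in> carrier A" and U: "U \<subseteq> carrier (PF n)"
    and upward: "\<And>g x. g \<in> U \<Longrightarrow> x \<in> carrier (PF n) \<Longrightarrow> g \<subseteq>\<^sub>m x \<Longrightarrow> x \<in> U"
    and eq: "\<And>g. g \<in> U \<Longrightarrow> pairing a (above g) = pairing b (above g)"
    and "g \<in> U"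
  shows "a g = b g"
  using \<open>g \<in> U\<close>
proof (induction "card {x \<in> carrier (PF n). g \<subseteq>\<^sub>m x}" arbitrary: g rule: less_induct)
  case less
  define R where "R f = (\<Oplus>x\<in>carrier (PF n) - {g}. f x \<otimes> above g x)" for f
  have g: "g \<in> carrier (PF n)"
    using less.prems U by auto
  have split: "pairing f (above g) = f g \<oplus> R f" if f: "f \<in> carrier A" for f
  proof -
    have "pairing f (above g) = (\<Oplus>x\<in>insert g (carrier (PF n) - {g}). f x \<otimes> above g x)"
      using g by (simp add: pairing_def insert_absorb)
    also have "\<dots> = f g \<otimes> above g g \<oplus> R f"
      unfolding R_def using f g by (intro finsum_insert) auto
    finally show ?thesis
      using f g by (simp add: above_def)
  qed
  have "a x \<otimes> above g x = b x \<otimes> above g x" if x: "x \<in> carrier (PF n)" "x \<noteq> g" for x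
  proof (cases "g \<subseteq>\<^sub>m x")
    case True
    have "\<not> x \<subseteq>\<^sub>m g"
      using map_le_antisym[OF True] x(2) by blast
    then have "{y \<in> carrier (PF n). x \<subseteq>\<^sub>m y} \<subset> {y \<in> carrier (PF n). g \<subseteq>\<^sub>m y}"
      using map_le_trans[OF True] g map_le_refl[of g] by (intro psubsetI) auto
    then have "card {y \<in> carrier (PF n). x \<subseteq>\<^sub>m y} < card {y \<in> carrier (PF n). g \<subseteq>\<^sub>m y}"
      by (rule psubset_card_mono[rotated]) (simp add: finite_carrier_PF)
    then have "a x = b x"
      by (rule less.hyps) (rule upward[OF less.prems x(1) True])
    then show ?thesis by simp
  qed (use a b x in \<open>simp add: above_def\<close>)
  then have "R a = R b"
    unfolding R_def using b by (intro finsum_cong') auto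
  moreover have "R b \<in> carrier K"
    unfolding R_def using b by (intro finsum_closed) auto
  ultimately show ?case
    using eq[OF less.prems] a b g by (simp add: split)
qed

lemma connected_A\<^sub>0: "connected_algebra K A\<^sub>0"
proof (rule connected_A\<^sub>0I)
  fix e assume e: "e \<in> carrier A"
    and comm: "\<And>f m. f \<in> carrier A \<Longrightarrow> m \<in> carrier (PF n) \<Longrightarrow> m \<noteq> Map.empty
      \<Longrightarrow> (e \<otimes>\<^bsub>A\<^esub> f) m = (f \<otimes>\<^bsub>A\<^esub> e) m"
    and idem: "\<And>m. m \<in> carrier (PF n) \<Longrightarrow> m \<noteq> Map.empty \<Longrightarrow> (e \<otimes>\<^bsub>A\<^esub> e) m = e m"
  have PF_simps [simp]: "mult (PF n) = (\<circ>\<^sub>m)" "one (PF n) = Some |` {1..n}"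
    by (simp_all add: PF_def)
  \<comment> \<open>Commutation with a basis element, seen through \<open>above g\<close>. For
    nonempty \<open>g\<close> this functional vanishes at the empty map, the one place where
    commutation is not given.\<close>
  have swap: "pairing e (\<lambda>x. above g (x \<circ>\<^sub>m b)) = pairing e (\<lambda>x. above g (b \<circ>\<^sub>m x))"
    if b: "b \<in> carrier (PF n)" and g: "g \<noteq> Map.empty" for b g
  proof -
    have "pairing (e \<otimes>\<^bsub>A\<^esub> \<delta> b) (above g) = pairing (\<delta> b \<otimes>\<^bsub>A\<^esub> e) (above g)"
      using e g by (intro pairing_cong_left comm) auto
    then show ?thesis
      using e b by (simp add: pairing_mult_basis_element)
  qed

  \<comment> \<open>commute \<open>e\<close> with the partial identity on \<open>ran g\<close>\<close>
  have not_id: "pairing e (above g) = \<zero>" if g: "g \<in> carrier (PF n)" "\<not> g \<subseteq>\<^sub>m Some" for g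
  proof -
    let ?b = "Some |` ran g"
    have b: "?b \<in> carrier (PF n)"
      using g(1) by (fastforce simp: in_carrier_PF_iff restrict_map_def ran_def split: if_splits)
    \<comment> \<open>All values of \<open>g\<close> lie in its range, so cutting down the values of
      \<open>x\<close> to that range does not affect whether \<open>g\<close> is extended.\<close>
    have "g \<subseteq>\<^sub>m ?b \<circ>\<^sub>m x \<longleftrightarrow> g \<subseteq>\<^sub>m x" for x
    proof -
      have "g m = (?b \<circ>\<^sub>m x) m \<longleftrightarrow> g m = x m" if "m \<in> dom g" for m
        using that by (auto simp: map_comp_def restrict_map_def ran_def split: option.splits)
      then show ?thesis
        unfolding map_le_def by (intro ball_cong refl)
    qed
    then have "pairing e (above g) = pairing e (\<lambda>x. above g (?b \<circ>\<^sub>m x))"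
      by (simp add: above_def[abs_def])
    also have "\<dots> = pairing e (\<lambda>x. above g (x \<circ>\<^sub>m ?b))"
      using b g by (intro swap[symmetric]) auto
    also have "\<dots> = \<zero>"
    proof (rule pairing_eq_zero)
      fix x assume x: "x \<in> carrier (PF n)"
      \<comment> \<open>The composite is undefined outside \<open>ran g\<close>. If it extended
        \<open>g\<close>, then the domain of \<open>g\<close> would lie in its range, and
        \<open>g\<close> would be a partial identity.\<close>
      have "\<not> g \<subseteq>\<^sub>m x \<circ>\<^sub>m ?b"
      proof
        assume le: "g \<subseteq>\<^sub>m x \<circ>\<^sub>m ?b"
        have "m \<in> ran g" if "m \<in> dom g" for m
        proof (rule ccontr)
          assume "m \<notin> ran g"
          then have "(x \<circ>\<^sub>m ?b) m = None"
            by (simp add: map_comp_def)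
          moreover have "g m = (x \<circ>\<^sub>m ?b) m"
            using le that by (simp add: map_le_def)
          ultimately show False
            using that by (simp add: domIff)
        qed
        then show False
          using partial_identity_if_dom_subset_ran[OF g(1)] g(2) by blast
      qed
      then show "e x \<otimes> above g (x \<circ>\<^sub>m ?b) = \<zero>"
        using e x by (simp add: above_def)
    qed
    finally show ?thesis .
  qed

  have e_zero: "e g = \<zero>" if "g \<in> carrier (PF n)" "\<not> g \<subseteq>\<^sub>m Some" for g
  proof -
    \<comment> \<open>Closed under extension, because every restriction of a partial identity is
      again one.\<close>
    let ?U = "{g \<in> carrier (PF n). \<not> g \<subseteq>\<^sub>m Some}"
    have "e g = zero A g"
    proof (rule eq_if_pairing_above_eq[where U = ?U])
      fix h x assume "h \<in> ?U" "x \<in> carrier (PF n)" and le: "h \<subseteq>\<^sub>m x"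
      then show "x \<in> ?U"
        using map_le_trans[OF le, of Some] by blast
    next
      fix h assume "h \<in> ?U"
      then have "pairing e (above h) = \<zero>"
        using not_id by blast
      also have "\<dots> = pairing (zero A) (above h)"
        by (rule pairing_eq_zero[symmetric]) simp
      finally show "pairing e (above h) = pairing (zero A) (above h)" .
    qed (use that e in auto)
    then show ?thesis
      using that by simp
  qed

  let ?p = "[1 \<mapsto> 1] :: nat \<rightharpoonup> nat"
  \<comment> \<open>The sum at the partial identity on {1}. Every nonempty domain maps onto {1}, so
    the sums at all other partial identities can be compared with this one.\<close>
  define c where "c = pairing e (above ?p)"
  have c: "c \<in> carrier K"
    unfolding c_def using e by auto
  have p_le_iff: "?p \<subseteq>\<^sub>m x \<longleftrightarrow> x 1 = Some 1" for x
    by (auto simp: map_le_def)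
  \<comment> \<open>commute \<open>e\<close> with the constant map from \<open>X\<close> to 1\<close>
  have partial_id: "pairing e (above (Some |` X)) = c" if X: "X \<subseteq> {1..n}" "X \<noteq> {}" for X
  proof -
    let ?k = "\<lambda>x. if x \<in> X then Some 1 else None :: nat option"
    have k: "?k \<in> carrier (PF n)"
      using X by (auto simp: in_carrier_PF_iff split: if_splits)
    \<comment> \<open>On the nonempty set X the composite has the constant value of \<open>x\<close>
      at 1, so it extends \<open>?k\<close> exactly when \<open>x\<close> fixes 1.\<close>
    have "?k \<subseteq>\<^sub>m x \<circ>\<^sub>m ?k \<longleftrightarrow> ?p \<subseteq>\<^sub>m x" for x
      using X(2) unfolding p_le_iff by (auto simp: map_le_def dom_def)
    then have "c = pairing e (\<lambda>x. above ?k (x \<circ>\<^sub>m ?k))"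
      by (simp add: c_def above_def[abs_def])
    also have "\<dots> = pairing e (\<lambda>x. above ?k (?k \<circ>\<^sub>m x))"
      using X(2) k by (intro swap) (auto simp: fun_eq_iff)
    also have "\<dots> = pairing e (above (Some |` X))"
    proof (rule pairing_cong)
      fix x assume x: "x \<in> carrier (PF n)"
      \<comment> \<open>Only partial identities \<open>x\<close> matter, since \<open>e\<close>
        vanishes at all other maps. For these, \<open>?k\<close> after \<open>x\<close> extends
        \<open>?k\<close> exactly when \<open>x\<close> is defined on all of X.\<close>
      show "e x \<otimes> above ?k (?k \<circ>\<^sub>m x) = e x \<otimes> above (Some |` X) x"
      proof (cases "x \<subseteq>\<^sub>m Some")
        case True
        have "?k m = (?k \<circ>\<^sub>m x) m \<longleftrightarrow> (Some |` X) m = x m" if "m \<in> X" for m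
          using True that by (cases "x m") (force simp: map_le_def dom_def)+
        moreover have "dom ?k = X" "dom (Some |` X) = X"
          by (auto simp: dom_def restrict_map_def)
        ultimately have "?k \<subseteq>\<^sub>m ?k \<circ>\<^sub>m x \<longleftrightarrow> Some |` X \<subseteq>\<^sub>m x"
          unfolding map_le_def by simp
        then show ?thesis
          by (simp add: above_def)
      qed (simp add: e_zero[OF x])
    qed (use e in auto)
    finally show ?thesis by simp
  qed

  have e_eq: "e g = (c \<odot>\<^bsub>A\<^esub> one A) g" if "g \<in> carrier (PF n)" "g \<noteq> Map.empty" for g
  proof (rule eq_if_pairing_above_eq[where U = "carrier (PF n) - {Map.empty}"])
    fix h assume h: "h \<in> carrier (PF n) - {Map.empty}"
    have one: "one A = \<delta> (one (PF n))"
      by (simp add: monoid_algebra_def)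
    have "pairing (c \<odot>\<^bsub>A\<^esub> one A) (above h) = c \<otimes> pairing (one A) (above h)"
      using c by (intro pairing_smult_left) auto
    also have "\<dots> = c \<otimes> above h (one (PF n))"
      unfolding one using mon.one_closed by (subst pairing_basis_element) auto
    also have "\<dots> = pairing e (above h)"
    \<comment> \<open>The unit extends exactly the partial identities in the carrier. At such
      \<open>h\<close> both sums are \<open>c\<close>, by \<open>partial_id\<close> for its domain;
      at the other maps both vanish, by \<open>not_id\<close>.\<close>
    proof (cases "h \<subseteq>\<^sub>m Some")
      case True
      have "dom h \<subseteq> {1..n}"
        using h by (auto simp: PF_def)
      moreover have "h = Some |` dom h"
      proof
        fix x show "h x = (Some |` dom h) x"
          using True by (cases "x \<in> dom h") (auto simp: map_le_def restrict_map_def)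
      qed
      moreover have "h \<subseteq>\<^sub>m Some |` {1..n}"
        using True \<open>dom h \<subseteq> {1..n}\<close> by (auto simp: map_le_def restrict_map_def)
      ultimately show ?thesis
        using partial_id[of "dom h"] h c by (auto simp: above_def)
    next
      case False
      then have "\<not> h \<subseteq>\<^sub>m Some |` {1..n}"
        by (auto simp: map_le_def restrict_map_def split: if_splits)
      then show ?thesis
        using False h c by (simp add: above_def not_id)
    qed
    finally show "pairing e (above h) = pairing (c \<odot>\<^bsub>A\<^esub> one A) (above h)" by simp
  next
    fix h x assume "h \<in> carrier (PF n) - {Map.empty}" "x \<in> carrier (PF n)" "h \<subseteq>\<^sub>m x"
    then show "x \<in> carrier (PF n) - {Map.empty}"
      by (auto simp: map_le_def)
  qed (use e c that in auto)

  \<comment> \<open>An order-decreasing \<open>y\<close> that is defined at 1 must fix 1, so a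
    composite fixes 1 exactly when both factors do. This functional is therefore multiplicative, and
    idempotence of \<open>e\<close> gives c c = c.\<close>
  have "above ?p (x \<circ>\<^sub>m y) = above ?p x \<otimes> above ?p y" if "y \<in> carrier (PF n)" for x y
  proof (cases "y 1")
    case (Some w)
    then have "w = 1"
      using that by (auto simp: in_carrier_PF_iff intro: antisym)
    then show ?thesis
      using Some unfolding above_def p_le_iff by simp
  next
    case None
    then show ?thesis
      unfolding above_def p_le_iff by simp
  qed
  then have "pairing (e \<otimes>\<^bsub>A\<^esub> e) (above ?p) = c \<otimes> c"
    unfolding c_def using e by (intro pairing_mult_multiplicative) auto
  moreover have "pairing (e \<otimes>\<^bsub>A\<^esub> e) (above ?p) = c"
    unfolding c_def using e by (intro pairing_cong_left idem) auto
  ultimately have "c = \<zero> \<or> c = \<one>"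
    using m_lcancel[of c c \<one>] c by auto
  then show "(\<forall>m\<in>carrier (PF n). m \<noteq> Map.empty \<longrightarrow> e m = \<zero>)
      \<or> (\<forall>m\<in>carrier (PF n). m \<noteq> Map.empty \<longrightarrow> e m = \<delta> \<one>\<^bsub>PF n\<^esub> m)"
    using e_eq by auto
qed

end

theorem lemma4p35:
  fixes K :: "('k, 'p) ring_scheme" and n :: nat
  assumes "field K" and "n \<ge> 1"
  shows "algebra_isomorphic K (monoid_algebra K (PF n))
           (product_algebra (base_algebra K) (contracted_monoid_algebra K (PF n) Map.empty))
         \<and> connected_algebra K (base_algebra K)
         \<and> connected_algebra K (contracted_monoid_algebra K (PF n) Map.empty)"
proof -
  interpret PF_algebra K n
    using assms by (simp add: PF_algebra_def PF_algebra_axioms_def)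
  show ?thesis
    using algebra_isomorphic_product connected_base_algebra[OF assms(1)] connected_A\<^sub>0 by blast
qed

end
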